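(* Let $\alpha\ge\beta\ge-1/2$. Then for each non-negative sequence $f\in\ell^\infty(\mathbb{N})$ and each $t>0$, the sequence $W_t^{(\alpha,\beta)}f$ is non-negative, i.e. $W_t^{(\alpha,\beta)}f(n)\ge 0$ for all $n\in\mathbb{N}$.
   Context: Here $\mathbb{N}=\{0,1,2,\dots\}$. Let $P_n^{(\alpha,\beta)}$ be the Jacobi polynomials, defined by $(1-x)^\alpha(1+x)^\beta P_n^{(\alpha,\beta)}(x)=\frac{(-1)^n}{2^nn!}\frac{d^n}{dx^n}\big((1-x)^{\alpha+n}(1+x)^{\beta+n}\big)$, let $d\mu_{\alpha,\beta}(x)=(1-x)^\alpha(1+x)^\beta dx$ on $[-1,1]$, and let $p_n^{(\alpha,\beta)}=P_n^{(\alpha,\beta)}/\|P_n^{(\alpha,\beta)}\|_{L^2([-1,1],d\mu_{\alpha,\beta})}$. For $t\ge0$, $$K_t^{(\alpha,\beta)}(m,n)=\int_{-1}^1e^{-(1-x)t}p_m^{(\alpha,\beta)}(x)p_n^{(\alpha,\beta)}(x)\,d\mu_{\alpha,\beta}(x),\qquad W_t^{(\alpha,\beta)}f(n)=\sum_{m=0}^\infty f(m)K_t^{(\alpha,\beta)}(m,n).$$ For $\alpha,\beta\ge-1/2$ the series converges absolutely for every $f\in\ell^\infty(\mathbb{N})$. *)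

theory Defs
  imports "HOL-Analysis.Analysis" "HOL-Computational_Algebra.Polynomial"
begin

definition jacobi_weight :: "real \<Rightarrow> real \<Rightarrow> real \<Rightarrow> real" where
  "jacobi_weight \<alpha> \<beta> x = (1 - x) powr \<alpha> * (1 + x) powr \<beta>"

text \<open>Rodrigues' formula is imposed on the open interval, where real powers are unproblematic;
  it determines the polynomial uniquely, see \<open>jacobi_poly_ex1\<close> below.\<close>

definition is_jacobi_poly :: "real \<Rightarrow> real \<Rightarrow> nat \<Rightarrow> real poly \<Rightarrow> bool" where
  "is_jacobi_poly \<alpha> \<beta> n p \<longleftrightarrow>
     (\<forall>x\<in>{-1<..<1}. jacobi_weight \<alpha> \<beta> x * poly p x =
        (-1) ^ n / (2 ^ n * fact n) * (deriv ^^ n) (jacobi_weight (\<alpha> + real n) (\<beta> + real n)) x)"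

definition jacobi_poly :: "real \<Rightarrow> real \<Rightarrow> nat \<Rightarrow> real poly" where
  "jacobi_poly \<alpha> \<beta> n = (THE p. is_jacobi_poly \<alpha> \<beta> n p)"

lemma DERIV_jacobi_weight_poly:
  fixes a b x :: real
  assumes "x \<in> {-1<..<1}"
  shows "((\<lambda>x. jacobi_weight a b x * poly q x) has_real_derivative
           jacobi_weight (a - 1) (b - 1) x *
           poly (smult (- a) ([:1, 1:] * q) + smult b ([:1, -1:] * q) + [:1, 0, -1:] * pderiv q) x) (at x)"
proof -
  have pos: "1 - x > 0" "1 + x > 0"
    using assms by auto
  have w: "(1 - x) powr a = (1 - x) powr (a - 1) * (1 - x)"
          "(1 + x) powr b = (1 + x) powr (b - 1) * (1 + x)"
    using pos by (simp_all add: powr_diff)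
  have "((\<lambda>x. (1 - x) powr a * (1 + x) powr b * poly q x) has_real_derivative
          (- a * (1 - x) powr (a - 1) * (1 + x) powr b
           + (1 - x) powr a * (b * (1 + x) powr (b - 1))) * poly q x
          + (1 - x) powr a * (1 + x) powr b * poly (pderiv q) x) (at x)"
    using pos by (auto intro!: derivative_eq_intros simp: powr_diff field_simps)
  then show ?thesis
    unfolding jacobi_weight_def w by (simp add: algebra_simps)
qed

lemma funpow_deriv_jacobi_weight:
  fixes a b :: real
  shows "\<exists>q. \<forall>x\<in>{-1<..<1}.
           (deriv ^^ k) (jacobi_weight a b) x = jacobi_weight (a - real k) (b - real k) x * poly q x"
proof (induction k)
  case 0
  show ?case by (rule exI[of _ 1]) simp
next
  case (Suc k)
  then obtain q where q: "\<And>x. x \<in> {-1<..<1} \<Longrightarrow>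
      (deriv ^^ k) (jacobi_weight a b) x = jacobi_weight (a - real k) (b - real k) x * poly q x"
    by blast
  define r where "r = smult (- (a - real k)) ([:1, 1:] * q) + smult (b - real k) ([:1, -1:] * q)
                        + [:1, 0, -1:] * pderiv q"
  have "(deriv ^^ Suc k) (jacobi_weight a b) x =
          jacobi_weight (a - real (Suc k)) (b - real (Suc k)) x * poly r x"
    if x: "x \<in> {-1<..<1}" for x
  proof -
    have "((\<lambda>x. jacobi_weight (a - real k) (b - real k) x * poly q x) has_real_derivative
             jacobi_weight (a - real k - 1) (b - real k - 1) x * poly r x) (at x)"
      unfolding r_def by (rule DERIV_jacobi_weight_poly[OF x])
    then have "((deriv ^^ k) (jacobi_weight a b) has_real_derivative
             jacobi_weight (a - real k - 1) (b - real k - 1) x * poly r x) (at x)"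
      by (rule has_field_derivative_transform_within_open[where S = "{-1<..<1}"])
         (use x q in auto)
    then show ?thesis
      by (simp add: DERIV_imp_deriv algebra_simps)
  qed
  then show ?case by blast
qed

lemma jacobi_poly_ex1: "\<exists>!p. is_jacobi_poly \<alpha> \<beta> n p"
proof (rule ex_ex1I)
  obtain q where q: "\<And>x. x \<in> {-1<..<1} \<Longrightarrow>
      (deriv ^^ n) (jacobi_weight (\<alpha> + real n) (\<beta> + real n)) x = jacobi_weight \<alpha> \<beta> x * poly q x"
    using funpow_deriv_jacobi_weight[of n "\<alpha> + real n" "\<beta> + real n"]
    unfolding add_diff_cancel_right' by blast
  have "is_jacobi_poly \<alpha> \<beta> n (smult ((-1) ^ n / (2 ^ n * fact n)) q)"
    unfolding is_jacobi_poly_def using q by simp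
  then show "\<exists>p. is_jacobi_poly \<alpha> \<beta> n p" ..
next
  fix p q assume p: "is_jacobi_poly \<alpha> \<beta> n p" and q: "is_jacobi_poly \<alpha> \<beta> n q"
  have "poly p x = poly q x" if x: "x \<in> {-1<..<1}" for x
  proof -
    have "jacobi_weight \<alpha> \<beta> x \<noteq> 0"
      using x by (simp add: jacobi_weight_def)
    moreover have "jacobi_weight \<alpha> \<beta> x * poly p x = jacobi_weight \<alpha> \<beta> x * poly q x"
      using p q x by (simp add: is_jacobi_poly_def)
    ultimately show ?thesis by simp
  qed
  then have "{-1<..<1} \<subseteq> {x. poly (p - q) x = 0}" by auto
  moreover have "infinite {-1<..<(1::real)}" by simp
  ultimately have "infinite {x. poly (p - q) x = 0}"
    using finite_subset by blast
  then show "p = q"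
    using poly_roots_finite[of "p - q"] by auto
qed

lemma is_jacobi_poly_jacobi_poly: "is_jacobi_poly \<alpha> \<beta> n (jacobi_poly \<alpha> \<beta> n)"
  unfolding jacobi_poly_def by (rule theI'[OF jacobi_poly_ex1])

definition jacobi_measure :: "real \<Rightarrow> real \<Rightarrow> real measure" where
  "jacobi_measure \<alpha> \<beta> =
     density lborel (\<lambda>x. ennreal (indicator {-1..1} x * jacobi_weight \<alpha> \<beta> x))"

definition jacobi_norm :: "real \<Rightarrow> real \<Rightarrow> nat \<Rightarrow> real" where
  "jacobi_norm \<alpha> \<beta> n = sqrt (\<integral>x. (poly (jacobi_poly \<alpha> \<beta> n) x)\<^sup>2 \<partial>jacobi_measure \<alpha> \<beta>)"

definition jacobi_normalized :: "real \<Rightarrow> real \<Rightarrow> nat \<Rightarrow> real \<Rightarrow> real" where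
  "jacobi_normalized \<alpha> \<beta> n x = poly (jacobi_poly \<alpha> \<beta> n) x / jacobi_norm \<alpha> \<beta> n"

definition jacobi_heat_kernel :: "real \<Rightarrow> real \<Rightarrow> real \<Rightarrow> nat \<Rightarrow> nat \<Rightarrow> real" where
  "jacobi_heat_kernel \<alpha> \<beta> t m n =
     (\<integral>x. exp (- (1 - x) * t) * jacobi_normalized \<alpha> \<beta> m x * jacobi_normalized \<alpha> \<beta> n x
        \<partial>jacobi_measure \<alpha> \<beta>)"

definition jacobi_heat :: "real \<Rightarrow> real \<Rightarrow> real \<Rightarrow> (nat \<Rightarrow> real) \<Rightarrow> nat \<Rightarrow> real" where
  "jacobi_heat \<alpha> \<beta> t f n = (\<Sum>m. f m * jacobi_heat_kernel \<alpha> \<beta> t m n)"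

end

theory Submission
  imports Defs
begin

text \<open>Let \<open>p\<^sub>n\<close> be the normalised Jacobi polynomials and \<open>\<mu>\<close> their measure. Since
  \<open>-(1 - x) = (1 + x) - 2\<close>, the heat kernel has the expansion
  \<open>K\<^sub>t(m,n) = exp(-2t) \<Sum>\<^sub>k t^k/k! \<integral> (1 + x)^k p\<^sub>m p\<^sub>n d\<mu>\<close>,
  and it suffices that each moment \<open>\<integral> (1 + x)^k p\<^sub>m p\<^sub>n d\<mu>\<close> is non-negative. The moments are the
  entries of the \<open>k\<close>-th power of the Jacobi matrix of multiplication by \<open>1 + x\<close>, so only the
  entries of that tridiagonal matrix matter. On the diagonal they are integrals of
  \<open>(1 + x) p\<^sub>n\<^sup>2\<close>, and \<open>1 + x\<close> is non-negative on \<open>[-1,1]\<close>; next to it they are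
  quotients of leading coefficients of consecutive polynomials, which are positive. This is
  \<open>moment_1_nonneg\<close>, and \<open>moment_nonneg\<close> follows by expanding \<open>(1 + x) p\<^sub>n\<close> in the
  orthonormal sequence.

  An infinite sum in HOL has a meaningful value only if it converges, so the convergence of
  \<open>\<Sum>\<^sub>m f(m) K\<^sub>t(m,n)\<close> is part of the claim. A moment is at most \<open>2^k\<close>, and it vanishes if
  \<open>k + n < m\<close> because the matrix is tridiagonal. Hence the expansion of \<open>K\<^sub>t(m,n)\<close> starts
  no earlier than \<open>k = m - n\<close>, and \<open>K\<^sub>t(m,n)\<close> decays geometrically in \<open>m\<close> (\<open>heat_kernel_le\<close>).

  All of this works for any orthonormal sequence of polynomials with positive leading
  coefficients on \<open>[-1,1]\<close>. For the Jacobi polynomials, Rodrigues' formula is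
  unrolled into a recursion that passes from the parameters \<open>(a + 1, b + 1)\<close> to \<open>(a, b)\<close> and raises the
  degree by one. It shows that the leading coefficients are positive
  (\<open>coeff_rodrigues_sign\<close>) and, by one integration by parts in each step, that the
  \<open>n\<close>-th polynomial is orthogonal to all polynomials of lower degree
  (\<open>rodrigues_orthogonal\<close>).\<close>

section \<open>Integrating polynomials against a measure on the interval\<close>

locale interval_measure = finite_measure M for M :: "real measure" +
  assumes sets_M [measurable_cong]: "sets M = sets borel"
    and supported: "AE x in M. x \<in> {-1..1}"
begin

definition mean :: "real poly \<Rightarrow> real" where
  "mean q = (\<integral>x. poly q x \<partial>M)"

lemma borel_measurable_poly [measurable]: "poly q \<in> borel_measurable M"
  using borel_measurable_continuous_onI[of "poly q"]
  by (simp add: continuous_on_poly measurable_cong_sets[OF sets_M refl])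

lemma integrable_poly: "integrable M (poly q)"
proof -
  have "bounded (poly q ` {-1..1})"
    by (intro compact_imp_bounded compact_continuous_image continuous_intros) auto
  then obtain B where "\<And>x. x \<in> {-1..1} \<Longrightarrow> norm (poly q x) \<le> B"
    unfolding bounded_iff by blast
  then show ?thesis
    by (intro integrable_const_bound[where B = B] eventually_mono[OF supported]) auto
qed

lemma mean_add: "mean (q + r) = mean q + mean r"
  by (simp add: mean_def integrable_poly)

lemma mean_diff: "mean (q - r) = mean q - mean r"
  by (simp add: mean_def integrable_poly)

lemma mean_smult: "mean (smult c q) = c * mean q"
  by (simp add: mean_def)

lemma mean_0 [simp]: "mean 0 = 0"
  by (simp add: mean_def)

lemma mean_sum: "mean (\<Sum>i\<in>A. q i) = (\<Sum>i\<in>A. mean (q i))"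
  by (induction A rule: infinite_finite_induct) (simp_all add: mean_add)

lemma mean_nonneg: "(\<And>x. x \<in> {-1..1} \<Longrightarrow> poly q x \<ge> 0) \<Longrightarrow> mean q \<ge> 0"
  unfolding mean_def by (intro integral_nonneg_AE eventually_mono[OF supported]) auto

end

section \<open>The heat kernel of a sequence of orthonormal polynomials\<close>

lemma exp_series_sums: "(\<lambda>k. t ^ k / fact k) sums exp (t :: real)"
  using exp_converges[of t] by (simp add: divide_inverse mult.commute)

text \<open>Orthogonality to all polynomials of lower degree, rather than between members of the
  sequence only, is what integration by parts yields from Rodrigues' formula.\<close>

locale orthonormal_polynomials = interval_measure +
  fixes p :: "nat \<Rightarrow> real poly"
  assumes degree_p: "degree (p n) = n"
    and lead_coeff_pos: "lead_coeff (p n) > 0"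
    and orthogonal: "degree q < n \<Longrightarrow> mean (p n * q) = 0"
    and normalized: "mean (p n * p n) = 1"
begin

lemma orthogonal_if_coeff_eq_0:
  assumes "\<And>i. i \<ge> n \<Longrightarrow> coeff q i = 0"
  shows "mean (p n * q) = 0"
proof (cases "q = 0")
  case False
  then have "degree q < n"
    using assms[of "degree q"] by (metis leading_coeff_0_iff not_le)
  then show ?thesis by (rule orthogonal)
qed simp

text \<open>Subtracting the multiple of \<open>p\<^sub>N\<close> that cancels the coefficient of degree \<open>N\<close> leaves a
  polynomial that is covered by the induction hypothesis and is orthogonal to \<open>p\<^sub>N\<close>. The bound is put on
  coefficients, not on the degree, so that \<open>N = 0\<close> means \<open>q = 0\<close>.\<close>

lemma orthogonal_expansion:
  assumes "\<And>i. i \<ge> N \<Longrightarrow> coeff q i = 0"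
  shows "q = (\<Sum>j<N. smult (mean (p j * q)) (p j))"
  using assms
proof (induction N arbitrary: q)
  case 0
  then show ?case by (simp add: poly_eq_iff)
next
  case (Suc N)
  define c where "c = coeff q N / lead_coeff (p N)"
  define r where "r = q - smult c (p N)"
  have r: "coeff r i = 0" if "i \<ge> N" for i
  proof (cases "i = N")
    case True
    then show ?thesis
      using lead_coeff_pos[of N] by (simp add: r_def c_def degree_p)
  next
    case False
    then show ?thesis
      using that Suc.prems[of i] by (simp add: r_def coeff_eq_0 degree_p)
  qed
  have q: "q = r + smult c (p N)"
    by (simp add: r_def)
  have "mean (p j * q) = mean (p j * r)" if "j < N" for j
    using orthogonal[of "p j" N] that
    by (simp add: q distrib_left mean_add mean_smult degree_p mult.commute[of "p j" "p N"])
  moreover have "mean (p N * q) = c"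
    using orthogonal_if_coeff_eq_0[OF r]
    by (simp add: q distrib_left mean_add mean_smult normalized)
  ultimately show ?case
    using Suc.IH[OF r] by (simp add: q[symmetric] del: mult_smult_right)
qed

text \<open>The entry \<open>(m, n)\<close> of the \<open>k\<close>-th power of the Jacobi matrix of multiplication by
  \<open>1 + x\<close>.\<close>

definition moment :: "nat \<Rightarrow> nat \<Rightarrow> nat \<Rightarrow> real" where
  "moment k m n = mean ([:1, 1:] ^ k * (p m * p n))"

lemma moment_commute: "moment k m n = moment k n m"
  by (simp add: moment_def mult.commute)

lemma degree_linear_factor_p: "degree ([:1, 1:] * p n) = Suc n"
proof -
  have "p n \<noteq> 0" using lead_coeff_pos[of n] by auto
  then show ?thesis by (subst degree_mult_eq) (auto simp: degree_p)
qed

text \<open>By symmetry let \<open>m \<le> n\<close>. The polynomial \<open>(1 + x) p\<^sub>m\<close> has degree \<open>m + 1\<close>, so the moment is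
  zero if \<open>m + 1 < n\<close>. If \<open>m + 1 = n\<close>, then \<open>(1 + x) p\<^sub>m\<close> differs from \<open>c p\<^sub>n\<close>, where \<open>c\<close> is the
  quotient of the leading coefficients, by a polynomial of lower degree, and the moment
  equals \<open>c\<close>.\<close>

lemma moment_1_nonneg: "moment 1 m n \<ge> 0"
proof (induction m n rule: linorder_wlog)
  case (le m n)
  have eq: "moment 1 m n = mean (p n * ([:1, 1:] * p m))"
    unfolding moment_def power_one_right by (simp only: mult_ac)
  consider "m = n" | "n = Suc m" | "Suc m < n"
    using le by linarith
  then show ?case
  proof cases
    case 1
    have "poly ([:1, 1:] ^ 1 * (p n * p n)) x = (1 + x) * (poly (p n) x)\<^sup>2" for x
      by (simp add: power2_eq_square algebra_simps)
    then show ?thesis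
      unfolding moment_def 1 by (intro mean_nonneg) simp
  next
    case 2
    define c where "c = lead_coeff (p m) / lead_coeff (p n)"
    define r where "r = [:1, 1:] * p m - smult c (p n)"
    have "c > 0"
      unfolding c_def by (intro divide_pos_pos lead_coeff_pos)
    have "coeff r i = 0" if "i \<ge> n" for i
    proof (cases "i = n")
      case True
      then show ?thesis
        using lead_coeff_pos[of n] 2 by (simp add: r_def c_def degree_p coeff_eq_0)
    next
      case False
      then show ?thesis
        using that 2 by (simp add: r_def coeff_eq_0 degree_p coeff_pCons split: nat.splits)
    qed
    then have "mean (p n * r) = 0"
      by (rule orthogonal_if_coeff_eq_0)
    moreover have "mean (p n * ([:1, 1:] * p m)) = mean (p n * (smult c (p n) + r))"
      by (simp add: r_def)
    ultimately have "mean (p n * ([:1, 1:] * p m)) = c"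
      by (simp only: distrib_left mean_add mult_smult_right mean_smult normalized
          mult_1_right add_0_right)
    then show ?thesis
      using \<open>c > 0\<close> unfolding eq by simp
  next
    case 3
    then have "mean (p n * ([:1, 1:] * p m)) = 0"
      by (intro orthogonal) (simp only: degree_linear_factor_p)
    then show ?thesis unfolding eq by simp
  qed
qed (simp add: moment_commute)

text \<open>Multiplication of matrices; the range of \<open>j\<close> is finite since \<open>(1 + x) p\<^sub>n\<close> has degree
  \<open>n + 1\<close>.\<close>

lemma moment_Suc: "moment (Suc k) m n = (\<Sum>j<n + 2. moment 1 j n * moment k m j)"
proof -
  have "[:1, 1:] * p n = (\<Sum>j<n + 2. smult (mean (p j * ([:1, 1:] * p n))) (p j))"
    by (rule orthogonal_expansion) (rule coeff_eq_0, unfold degree_linear_factor_p, simp)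
  also have "\<dots> = (\<Sum>j<n + 2. smult (moment 1 j n) (p j))"
    unfolding moment_def power_one_right by (simp only: mult_ac)
  finally have expansion: "[:1, 1:] * p n = (\<Sum>j<n + 2. smult (moment 1 j n) (p j))" .
  have "[:1, 1:] ^ Suc k * (p m * p n) = [:1, 1:] ^ k * p m * ([:1, 1:] * p n)"
    by (simp only: power_Suc mult_ac)
  also have "\<dots> = (\<Sum>j<n + 2. smult (moment 1 j n) ([:1, 1:] ^ k * (p m * p j)))"
    unfolding expansion by (simp only: sum_distrib_left mult_smult_right mult.assoc)
  finally show ?thesis
    by (simp only: moment_def[of "Suc k"] mean_sum mean_smult moment_def[of k])
qed

lemma moment_0: "moment 0 m n = (if m = n then 1 else 0)"
  using orthogonal[of "p m" n] orthogonal[of "p n" m]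
  by (cases m n rule: linorder_cases) (auto simp: moment_def normalized degree_p mult.commute)

lemma moment_nonneg: "moment k m n \<ge> 0"
proof (induction k arbitrary: n)
  case 0
  then show ?case by (simp add: moment_0)
next
  case (Suc k)
  then show ?case
    unfolding moment_Suc by (intro sum_nonneg mult_nonneg_nonneg moment_1_nonneg)
qed

lemma moment_eq_0: "k + n < m \<Longrightarrow> moment k m n = 0"
proof (induction k arbitrary: n)
  case 0
  then show ?case by (simp add: moment_0)
next
  case (Suc k)
  then show ?case
    unfolding moment_Suc by (intro sum.neutral) auto
qed

text \<open>On \<open>[-1,1]\<close> one has \<open>0 \<le> 1 + x \<le> 2\<close>, and \<open>2 \<bar>p\<^sub>m p\<^sub>n\<bar> \<le> p\<^sub>m\<^sup>2 + p\<^sub>n\<^sup>2\<close> has integral at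
  most \<open>2\<close>. The absolute value stays inside the integral because the exchange of series and
  integral below needs this form.\<close>

lemma integral_power_abs_le:
  "(\<integral>x. \<bar>poly ([:1, 1:] ^ k * (p m * p n)) x\<bar> \<partial>M) \<le> 2 ^ k"
proof -
  define q where "q = smult (2 ^ k / 2) (p m * p m + p n * p n)"
  have "\<bar>poly ([:1, 1:] ^ k * (p m * p n)) x\<bar> \<le> poly q x" if x: "x \<in> {-1..1}" for x
  proof -
    have "\<bar>(1 + x) ^ k\<bar> \<le> 2 ^ k"
      using x unfolding power_abs by (intro power_mono) auto
    moreover have "\<bar>poly (p m) x * poly (p n) x\<bar> \<le> ((poly (p m) x)\<^sup>2 + (poly (p n) x)\<^sup>2) / 2"
      using sum_squares_bound[of "poly (p m) x" "poly (p n) x"]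
        sum_squares_bound[of "- poly (p m) x" "poly (p n) x"] by (simp add: abs_le_iff)
    ultimately have "\<bar>(1 + x) ^ k\<bar> * \<bar>poly (p m) x * poly (p n) x\<bar>
        \<le> 2 ^ k * (((poly (p m) x)\<^sup>2 + (poly (p n) x)\<^sup>2) / 2)"
      by (intro mult_mono) auto
    then show ?thesis
      by (simp add: q_def abs_mult power2_eq_square)
  qed
  then have "(\<integral>x. \<bar>poly ([:1, 1:] ^ k * (p m * p n)) x\<bar> \<partial>M) \<le> mean q"
    unfolding mean_def
    by (intro integral_mono_AE integrable_abs integrable_poly eventually_mono[OF supported])
  also have "mean q = 2 ^ k"
    by (simp add: q_def mean_smult mean_add normalized)
  finally show ?thesis .
qed

lemma moment_le: "moment k m n \<le> 2 ^ k"
proof -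
  have "moment k m n \<le> (\<integral>x. \<bar>poly ([:1, 1:] ^ k * (p m * p n)) x\<bar> \<partial>M)"
    unfolding moment_def mean_def
    by (intro integral_mono integrable_abs integrable_poly) auto
  with integral_power_abs_le show ?thesis by (rule order_trans[rotated])
qed

definition heat_kernel :: "real \<Rightarrow> nat \<Rightarrow> nat \<Rightarrow> real" where
  "heat_kernel t m n = (\<integral>x. exp (- (1 - x) * t) * poly (p m) x * poly (p n) x \<partial>M)"

text \<open>The exponential series of \<open>t (1 + x)\<close> may be integrated term by term, because the
  integrals of the absolute values of its terms are bounded by \<open>(2t)^k/k!\<close>.\<close>

lemma heat_kernel_sums:
  assumes "t \<ge> 0"
  shows "(\<lambda>k. exp (- 2 * t) * (t ^ k / fact k * moment k m n)) sums heat_kernel t m n"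
proof -
  define g where "g k x = t ^ k / fact k * poly ([:1, 1:] ^ k * (p m * p n)) x" for k x
  have g: "g k x = (t * (1 + x)) ^ k / fact k * (poly (p m) x * poly (p n) x)" for k x
    by (simp add: g_def power_mult_distrib)
  have g_sums: "(\<lambda>k. g k x) sums (exp (t * (1 + x)) * (poly (p m) x * poly (p n) x))" for x
    unfolding g by (intro sums_mult2 exp_series_sums)
  have "summable (\<lambda>k. norm ((t * (1 + x)) ^ k / fact k))" for x :: real
    using summable_norm_exp[of "t * (1 + x)"] by (simp add: divide_inverse mult.commute)
  then have g_abs: "summable (\<lambda>k. norm (g k x))" for x
    unfolding g norm_mult[of _ "_ * _"] by (intro summable_mult2)
  have g_int: "integrable M (g k)" for k
    unfolding g_def by (intro integrable_mult_right integrable_poly)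
  have "(\<integral>x. norm (g k x) \<partial>M) \<le> (2 * t) ^ k / fact k" for k
  proof -
    have "(\<integral>x. norm (g k x) \<partial>M)
        = t ^ k / fact k * (\<integral>x. \<bar>poly ([:1, 1:] ^ k * (p m * p n)) x\<bar> \<partial>M)"
      using assms unfolding g_def real_norm_def abs_mult[of "_ / _"]
      by (subst integral_mult_right_zero) simp
    also have "\<dots> \<le> t ^ k / fact k * 2 ^ k"
      using assms by (intro mult_left_mono integral_power_abs_le) auto
    finally show ?thesis by (simp add: power_mult_distrib mult.commute)
  qed
  then have "summable (\<lambda>k. \<integral>x. norm (g k x) \<partial>M)"
    by (intro summable_comparison_test'[OF sums_summable[OF exp_series_sums[of "2 * t"]], of 0])
       simp
  then have "(\<lambda>k. integral\<^sup>L M (g k)) sums (\<integral>x. (\<Sum>k. g k x) \<partial>M)"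
    using g_int g_abs by (intro sums_integral) auto
  then have "(\<lambda>k. exp (- 2 * t) * integral\<^sup>L M (g k)) sums
      (exp (- 2 * t) * (\<integral>x. (\<Sum>k. g k x) \<partial>M))"
    by (rule sums_mult)
  moreover have "integral\<^sup>L M (g k) = t ^ k / fact k * moment k m n" for k
    unfolding g_def moment_def mean_def by (subst integral_mult_right_zero) simp
  moreover have "exp (- 2 * t) * (\<integral>x. (\<Sum>k. g k x) \<partial>M) = heat_kernel t m n"
  proof -
    have "exp (- 2 * t) * (\<Sum>k. g k x) = exp (- (1 - x) * t) * poly (p m) x * poly (p n) x" for x
    proof -
      have "exp (- (1 - x) * t) = exp (- 2 * t) * exp (t * (1 + x))"
        by (simp flip: exp_add) (simp add: algebra_simps)
      then show ?thesis by (simp add: sums_unique[OF g_sums, symmetric])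
    qed
    then show ?thesis
      unfolding heat_kernel_def by (subst integral_mult_right_zero[symmetric]) simp
  qed
  ultimately show ?thesis by simp
qed

lemma heat_kernel_nonneg:
  assumes "t \<ge> 0"
  shows "heat_kernel t m n \<ge> 0"
  using assms by (intro sums_le[OF _ sums_zero heat_kernel_sums[OF assms]])
    (intro mult_nonneg_nonneg divide_nonneg_nonneg moment_nonneg, auto)

text \<open>Only the terms with \<open>k + n \<ge> m\<close> survive, and for these \<open>2^k \<le> 2^(n-m) 4^k\<close>. The
  series with \<open>(4t)^k/k!\<close> then sums to \<open>exp(4t)\<close>.\<close>

lemma heat_kernel_le:
  assumes "t \<ge> 0"
  shows "heat_kernel t m n \<le> exp (2 * t) * 2 ^ n * (1 / 2) ^ m"
proof -
  have "t ^ k / fact k * moment k m n \<le> 2 ^ n * (1 / 2) ^ m * ((4 * t) ^ k / fact k)" for k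
  proof (cases "k + n < m")
    case True
    then show ?thesis using assms by (simp add: moment_eq_0)
  next
    case False
    then have "(2 :: real) ^ m \<le> 2 ^ (k + n)" by (intro power_increasing) auto
    then have "2 ^ k * 2 ^ m \<le> (2 ^ k * 2 ^ (k + n) :: real)" by simp
    also have "\<dots> = 2 ^ n * 4 ^ k"
      using power_mult_distrib[of "2 :: real" 2 k] by (simp add: power_add)
    finally have "2 ^ k \<le> (2 ^ n * (1 / 2) ^ m * 4 ^ k :: real)"
      by (simp add: field_simps)
    with moment_le have "moment k m n \<le> 2 ^ n * (1 / 2) ^ m * 4 ^ k"
      by (rule order_trans)
    then have "t ^ k / fact k * moment k m n \<le> t ^ k / fact k * (2 ^ n * (1 / 2) ^ m * 4 ^ k)"
      using assms by (intro mult_left_mono) auto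
    then show ?thesis by (simp add: power_mult_distrib mult_ac)
  qed
  then have "heat_kernel t m n \<le> exp (- 2 * t) * (2 ^ n * (1 / 2) ^ m * exp (4 * t))"
    by (intro sums_le[OF _ heat_kernel_sums[OF assms] sums_mult[OF sums_mult[OF exp_series_sums]]]
        mult_left_mono) auto
  also have "\<dots> = exp (2 * t) * 2 ^ n * (1 / 2) ^ m"
    using exp_add[of "- 2 * t" "4 * t"] by simp
  finally show ?thesis .
qed

lemma heat_semigroup_nonneg:
  assumes "t \<ge> 0" "bounded (range f)" "\<And>m. f m \<ge> 0"
  shows "(\<Sum>m. f m * heat_kernel t m n) \<ge> 0"
proof (rule suminf_nonneg)
  obtain B where B: "\<And>m. norm (f m) \<le> B"
    using assms(2) unfolding bounded_iff by blast
  have "B \<ge> 0" using order_trans[OF norm_ge_zero B] .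
  show "summable (\<lambda>m. f m * heat_kernel t m n)"
  proof (rule summable_comparison_test')
    show "summable (\<lambda>m. B * (exp (2 * t) * 2 ^ n * (1 / 2) ^ m))"
      by (intro summable_mult summable_geometric) simp
    show "norm (f m * heat_kernel t m n) \<le> B * (exp (2 * t) * 2 ^ n * (1 / 2) ^ m)" for m
      unfolding norm_mult using \<open>B \<ge> 0\<close> B heat_kernel_le[OF assms(1)] heat_kernel_nonneg[OF assms(1)]
      by (intro mult_mono) auto
  qed
qed (use assms heat_kernel_nonneg in auto)

end

section \<open>The Jacobi weight\<close>

text \<open>The substitution of \<open>(1 + x)/2\<close> turns the integrand of the Beta function into the Jacobi
  weight, up to the factor \<open>2 powr (a + b)\<close>.\<close>

lemma integrable_jacobi_weight:
  assumes "a > -1" "b > -1"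
  shows "integrable lborel (\<lambda>x. indicator {-1..1} x * jacobi_weight a b x)"
proof -
  have "integrable lborel (\<lambda>x. indicator {0..1} x *\<^sub>R (x powr b * (1 - x) powr a))"
    using integrable_Beta[of "b + 1" "a + 1"] assms by (simp add: set_integrable_def)
  then have "integrable lborel (\<lambda>x. 2 powr (a + b) *
      (indicator {0..1} (1/2 + 1/2 * x) *\<^sub>R ((1/2 + 1/2 * x) powr b * (1 - (1/2 + 1/2 * x)) powr a)))"
    by (intro integrable_mult_right lborel_integrable_real_affine) auto
  also have "(\<lambda>x. 2 powr (a + b) *
      (indicator {0..1} (1/2 + 1/2 * x) *\<^sub>R ((1/2 + 1/2 * x) powr b * (1 - (1/2 + 1/2 * x)) powr a)))
    = (\<lambda>x. indicator {-1..1} x * jacobi_weight a b x)"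
  proof
    fix x :: real
    show "2 powr (a + b) *
      (indicator {0..1} (1/2 + 1/2 * x) *\<^sub>R ((1/2 + 1/2 * x) powr b * (1 - (1/2 + 1/2 * x)) powr a))
      = indicator {-1..1} x * jacobi_weight a b x"
    proof (cases "x \<in> {-1..1}")
      case True
      have eqs: "1/2 + 1/2 * x = (1 + x) / 2" "1 - (1 + x) / 2 = (1 - x) / 2"
        by (simp_all add: field_simps)
      have "((1 + x) / 2) powr b = (1 + x) powr b / 2 powr b"
        "((1 - x) / 2) powr a = (1 - x) powr a / 2 powr a"
        using True by (simp_all add: powr_divide)
      moreover have "indicator {0..1} ((1 + x) / 2) = (1 :: real)"
        using True by simp
      ultimately show ?thesis
        unfolding eqs using True by (simp add: jacobi_weight_def powr_add)
    next
      case False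
      then show ?thesis by (auto simp: indicator_def)
    qed
  qed
  finally show ?thesis .
qed

lemma borel_measurable_jacobi_weight [measurable]: "jacobi_weight a b \<in> borel_measurable borel"
  unfolding jacobi_weight_def[abs_def] by measurable

lemma jacobi_weight_nonneg: "jacobi_weight a b x \<ge> 0"
  by (simp add: jacobi_weight_def)

lemma jacobi_weight_pos: "x \<in> {-1<..<1} \<Longrightarrow> jacobi_weight a b x > 0"
  by (simp add: jacobi_weight_def)

lemma interval_measure_jacobi:
  assumes "a > -1" "b > -1"
  shows "interval_measure (jacobi_measure a b)"
proof (intro interval_measure.intro finite_measureI interval_measure_axioms.intro)
  show "sets (jacobi_measure a b) = sets borel"
    by (simp add: jacobi_measure_def)
  show "AE x in jacobi_measure a b. x \<in> {-1..1}"
    unfolding jacobi_measure_def by (subst AE_density) (auto simp: indicator_def)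
  have "emeasure (jacobi_measure a b) (space (jacobi_measure a b))
      = (\<integral>\<^sup>+x. ennreal (indicator {-1..1} x * jacobi_weight a b x) \<partial>lborel)"
    unfolding jacobi_measure_def by (subst emeasure_density) auto
  also have "\<dots> < \<infinity>"
    using integrable_jacobi_weight[OF assms]
    by (subst nn_integral_eq_integral) (auto simp: jacobi_weight_nonneg)
  finally show "emeasure (jacobi_measure a b) (space (jacobi_measure a b)) \<noteq> \<infinity>"
    by simp
qed

text \<open>Integration by parts relates the means for different parameters, so the parameters have
  to be explicit arguments here.\<close>

definition jacobi_mean :: "real \<Rightarrow> real \<Rightarrow> real poly \<Rightarrow> real" where
  "jacobi_mean a b q = (\<integral>x. poly q x \<partial>jacobi_measure a b)"

lemma jacobi_mean_conv: "jacobi_mean a b q = interval_measure.mean (jacobi_measure a b) q"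
  if "a > -1" "b > -1"
  using interval_measure.mean_def[OF interval_measure_jacobi[OF that]] by (simp add: jacobi_mean_def)

lemma
  assumes "a > -1" "b > -1"
  shows integrable_jacobi_weight_poly:
      "integrable lborel (\<lambda>x. indicator {-1..1} x *\<^sub>R (jacobi_weight a b x * poly q x))"
    and jacobi_mean_lborel:
      "jacobi_mean a b q = (\<integral>x. indicator {-1..1} x *\<^sub>R (jacobi_weight a b x * poly q x) \<partial>lborel)"
proof -
  interpret interval_measure "jacobi_measure a b"
    by (rule interval_measure_jacobi[OF assms])
  have [measurable]: "poly q \<in> borel_measurable borel"
    by (intro borel_measurable_continuous_onI continuous_on_poly continuous_on_id)
  have nonneg: "indicator {-1..1} x * jacobi_weight a b x \<ge> 0" for x
    by (simp add: jacobi_weight_nonneg)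
  show "integrable lborel (\<lambda>x. indicator {-1..1} x *\<^sub>R (jacobi_weight a b x * poly q x))"
    using integrable_poly[of q] nonneg unfolding jacobi_measure_def
    by (subst (asm) integrable_density) (auto simp: mult.assoc)
  show "jacobi_mean a b q = (\<integral>x. indicator {-1..1} x *\<^sub>R (jacobi_weight a b x * poly q x) \<partial>lborel)"
    using nonneg unfolding jacobi_mean_def jacobi_measure_def
    by (subst integral_density) (auto simp: mult.assoc)
qed

section \<open>Rodrigues' formula\<close>

text \<open>The first-order operator for which \<open>(w\<^sub>a\<^sub>,\<^sub>b q)' = w\<^sub>a\<^sub>-\<^sub>1\<^sub>,\<^sub>b\<^sub>-\<^sub>1 (rodrigues_step a b q)\<close>, where
  \<open>w\<^sub>a\<^sub>,\<^sub>b\<close> is the Jacobi weight.\<close>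

definition rodrigues_step :: "real \<Rightarrow> real \<Rightarrow> real poly \<Rightarrow> real poly" where
  "rodrigues_step a b q =
     smult (- a) ([:1, 1:] * q) + smult b ([:1, -1:] * q) + [:1, 0, -1:] * pderiv q"

text \<open>The Jacobi polynomials without the factor \<open>(-1)^n/(2^n n!)\<close>. The recursion starts from the
  innermost derivative, hence it raises the parameters.\<close>

primrec rodrigues :: "real \<Rightarrow> real \<Rightarrow> nat \<Rightarrow> real poly" where
  "rodrigues a b 0 = 1"
| "rodrigues a b (Suc n) = rodrigues_step (a + 1) (b + 1) (rodrigues (a + 1) (b + 1) n)"

lemma DERIV_jacobi_weight_Suc:
  assumes "x \<in> {-1<..<1}"
  shows "((\<lambda>x. jacobi_weight (a + 1) (b + 1) x * poly q x) has_real_derivative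
    jacobi_weight a b x * poly (rodrigues_step (a + 1) (b + 1) q) x) (at x)"
  using DERIV_jacobi_weight_poly[OF assms, of "a + 1" "b + 1" q] by (simp add: rodrigues_step_def)

lemma funpow_deriv_rodrigues:
  assumes "x \<in> {-1<..<1}"
  shows "(deriv ^^ n) (jacobi_weight (a + real n) (b + real n)) x
    = jacobi_weight a b x * poly (rodrigues a b n) x"
  using assms
proof (induction n arbitrary: a b x)
  case (Suc n)
  have IH: "(deriv ^^ n) (jacobi_weight (a + real (Suc n)) (b + real (Suc n))) y
      = jacobi_weight (a + 1) (b + 1) y * poly (rodrigues (a + 1) (b + 1) n) y"
    if "y \<in> {-1<..<1}" for y
    using Suc.IH[OF that, of "a + 1" "b + 1"] by (simp add: add_ac)
  have "((deriv ^^ n) (jacobi_weight (a + real (Suc n)) (b + real (Suc n))) has_real_derivative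
      jacobi_weight a b x * poly (rodrigues a b (Suc n)) x) (at x)"
    unfolding rodrigues.simps
    by (rule has_field_derivative_transform_within_open[OF DERIV_jacobi_weight_Suc,
          where S = "{-1<..<1}"]) (use Suc.prems IH in auto)
  then show ?case
    by (simp add: DERIV_imp_deriv)
qed simp

lemma jacobi_poly_eq_rodrigues:
  "jacobi_poly a b n = smult ((-1) ^ n / (2 ^ n * fact n)) (rodrigues a b n)"
  unfolding jacobi_poly_def
  by (rule the1_equality[OF jacobi_poly_ex1]) (simp add: is_jacobi_poly_def funpow_deriv_rodrigues)

lemma coeff_rodrigues_step:
  assumes "degree q \<le> k"
  shows "coeff (rodrigues_step a b q) (Suc k) = - (a + b + real k) * coeff q k"
  using assms
  by (cases k) (auto simp: rodrigues_step_def coeff_eq_0 coeff_pderiv algebra_simps)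

lemma degree_rodrigues_step:
  assumes "degree q \<le> k"
  shows "degree (rodrigues_step a b q) \<le> Suc k"
proof (rule degree_le, intro allI impI)
  fix i assume "i > Suc k"
  then show "coeff (rodrigues_step a b q) i = 0"
    using assms
    by (auto simp: rodrigues_step_def coeff_eq_0 coeff_pderiv coeff_pCons split: nat.splits)
qed

lemma degree_rodrigues_le: "degree (rodrigues a b n) \<le> n"
  by (induction n arbitrary: a b) (auto intro: degree_rodrigues_step)

text \<open>Each step multiplies the leading coefficient by \<open>-(a + b + 2 + n)\<close>, which is negative.\<close>

lemma coeff_rodrigues_sign:
  assumes "a > -1" "b > -1"
  shows "(-1) ^ n * coeff (rodrigues a b n) n > 0"
  using assms
proof (induction n arbitrary: a b)
  case (Suc n)
  have "0 < (a + 1 + (b + 1) + real n) * ((-1) ^ n * coeff (rodrigues (a + 1) (b + 1) n) n)"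
    using Suc.prems by (intro mult_pos_pos Suc.IH) auto
  then show ?case
    by (simp add: coeff_rodrigues_step degree_rodrigues_le algebra_simps)
qed simp

lemma coeff_jacobi_poly_pos:
  assumes "a > -1" "b > -1"
  shows "coeff (jacobi_poly a b n) n > 0"
  using coeff_rodrigues_sign[OF assms, of n] by (simp add: jacobi_poly_eq_rodrigues)

lemma degree_jacobi_poly:
  assumes "a > -1" "b > -1"
  shows "degree (jacobi_poly a b n) = n"
proof (rule antisym)
  show "degree (jacobi_poly a b n) \<le> n"
    by (simp add: jacobi_poly_eq_rodrigues degree_rodrigues_le)
  show "n \<le> degree (jacobi_poly a b n)"
    using coeff_jacobi_poly_pos[OF assms, of n] by (intro le_degree) simp
qed

section \<open>Orthogonality\<close>

text \<open>The integrand is the derivative of \<open>w\<^sub>a\<^sub>+\<^sub>1\<^sub>,\<^sub>b\<^sub>+\<^sub>1 q\<close>, which is continuous on \<open>[-1,1]\<close> and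
  vanishes at both ends because the exponents \<open>a + 1\<close> and \<open>b + 1\<close> are positive.\<close>

lemma jacobi_mean_rodrigues_step:
  assumes "a > -1" "b > -1"
  shows "jacobi_mean a b (rodrigues_step (a + 1) (b + 1) q) = 0"
proof -
  let ?r = "rodrigues_step (a + 1) (b + 1) q"
  let ?W = "\<lambda>x. jacobi_weight (a + 1) (b + 1) x * poly q x"
  have "((\<lambda>x. jacobi_weight a b x * poly ?r x) has_integral ?W 1 - ?W (-1)) {-1..1}"
  proof (rule fundamental_theorem_of_calculus_interior)
    show "continuous_on {-1..1} ?W"
      unfolding jacobi_weight_def using assms by (intro continuous_intros continuous_on_powr') auto
    show "(?W has_vector_derivative jacobi_weight a b x * poly ?r x) (at x)"
      if "x \<in> {-1<..<1}" for x
      using DERIV_jacobi_weight_Suc[OF that]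
      by (simp add: has_real_derivative_iff_has_vector_derivative)
  qed simp
  then have "integral {-1..1} (\<lambda>x. jacobi_weight a b x * poly ?r x) = 0"
    using assms by (simp add: integral_unique jacobi_weight_def)
  moreover have "set_integrable lborel {-1..1} (\<lambda>x. jacobi_weight a b x * poly ?r x)"
    unfolding set_integrable_def by (rule integrable_jacobi_weight_poly[OF assms])
  ultimately show ?thesis
    using set_borel_integral_eq_integral(2)[of "{-1..1}" "\<lambda>x. jacobi_weight a b x * poly ?r x"]
    by (simp add: jacobi_mean_lborel[OF assms] set_lebesgue_integral_def)
qed

text \<open>The product rule for \<open>rodrigues_step\<close> leaves the term \<open>(1 - x\<^sup>2) q r'\<close>, and its factor
  \<open>1 - x\<^sup>2\<close> raises both exponents of the weight by one.\<close>

lemma jacobi_mean_by_parts: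
  assumes "a > -1" "b > -1"
  shows "jacobi_mean a b (rodrigues_step (a + 1) (b + 1) q * r)
    = - jacobi_mean (a + 1) (b + 1) (q * pderiv r)"
proof -
  interpret interval_measure "jacobi_measure a b"
    by (rule interval_measure_jacobi[OF assms])
  have "rodrigues_step (a + 1) (b + 1) q * r
      = rodrigues_step (a + 1) (b + 1) (q * r) - [:1, 0, -1:] * (q * pderiv r)"
    unfolding rodrigues_step_def pderiv_mult by (simp add: algebra_simps)
  then have "jacobi_mean a b (rodrigues_step (a + 1) (b + 1) q * r)
      = - jacobi_mean a b ([:1, 0, -1:] * (q * pderiv r))"
    using jacobi_mean_rodrigues_step[OF assms, of "q * r"]
    by (simp add: jacobi_mean_conv[OF assms] mean_diff)
  also have "jacobi_mean a b ([:1, 0, -1:] * (q * pderiv r))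
      = jacobi_mean (a + 1) (b + 1) (q * pderiv r)"
  proof -
    have "indicator {-1..1} x *\<^sub>R (jacobi_weight a b x * poly ([:1, 0, -1:] * (q * pderiv r)) x)
      = indicator {-1..1} x *\<^sub>R (jacobi_weight (a + 1) (b + 1) x * poly (q * pderiv r) x)" for x
      by (cases "x \<in> {-1..1}")
        (auto simp: jacobi_weight_def powr_add powr_one algebra_simps simp del: poly_mult)
    then show ?thesis
      using assms by (simp only: jacobi_mean_lborel)
  qed
  finally show ?thesis .
qed

lemma rodrigues_orthogonal:
  assumes "a > -1" "b > -1" "degree r < n"
  shows "jacobi_mean a b (rodrigues a b n * r) = 0"
  using assms
proof (induction n arbitrary: a b r)
  case (Suc n)
  have "jacobi_mean (a + 1) (b + 1) (rodrigues (a + 1) (b + 1) n * pderiv r) = 0"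
  proof (cases "degree r = 0")
    case True
    then show ?thesis by (auto elim!: degree_eq_zeroE simp: jacobi_mean_def pderiv_pCons)
  next
    case False
    then show ?thesis using Suc.prems by (intro Suc.IH) (auto simp: degree_pderiv)
  qed
  then show ?case
    using Suc.prems by (simp add: jacobi_mean_by_parts)
qed simp

lemma jacobi_poly_orthogonal:
  assumes "a > -1" "b > -1" "degree r < n"
  shows "jacobi_mean a b (jacobi_poly a b n * r) = 0"
  using rodrigues_orthogonal[OF assms]
  by (simp add: jacobi_poly_eq_rodrigues jacobi_mean_def)

section \<open>Normalisation\<close>

text \<open>If the integral vanished, then \<open>q\<close> would vanish almost everywhere on \<open>(-1,1)\<close>, but its
  roots are finitely many and \<open>(-1,1)\<close> is no null set.\<close>

lemma jacobi_mean_square_pos: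
  assumes "a > -1" "b > -1" "q \<noteq> 0"
  shows "jacobi_mean a b (q * q) > 0"
proof -
  let ?g = "\<lambda>x. indicator {-1..1} x *\<^sub>R (jacobi_weight a b x * poly (q * q) x)"
  have g: "integrable lborel ?g" "\<And>x. ?g x \<ge> 0"
    using integrable_jacobi_weight_poly[OF assms(1,2), of "q * q"]
    by (auto simp: jacobi_weight_nonneg)
  have "integral\<^sup>L lborel ?g \<noteq> 0"
  proof
    assume "integral\<^sup>L lborel ?g = 0"
    then have "AE x in lborel. ?g x = 0"
      using g by (subst (asm) integral_nonneg_eq_0_iff_AE) auto
    moreover have "AE x in lborel. x \<notin> {x. poly q x = 0}"
      by (intro AE_not_in finite_imp_null_set_lborel poly_roots_finite assms)
    ultimately have "AE x in lborel. x \<notin> {-1<..<1::real}"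
      by eventually_elim (use jacobi_weight_pos[of _ a b] in force)
    then have "{-1<..<1::real} \<in> null_sets lborel"
      by (simp add: AE_iff_null_sets)
    then show False by (simp add: null_sets_def)
  qed
  with g(2) show ?thesis
    by (simp add: jacobi_mean_lborel[OF assms(1,2)] less_le del: poly_mult)
qed

definition jacobi_orthonormal :: "real \<Rightarrow> real \<Rightarrow> nat \<Rightarrow> real poly" where
  "jacobi_orthonormal a b n = smult (1 / jacobi_norm a b n) (jacobi_poly a b n)"

lemma poly_jacobi_orthonormal: "poly (jacobi_orthonormal a b n) x = jacobi_normalized a b n x"
  by (simp add: jacobi_orthonormal_def jacobi_normalized_def)

lemma jacobi_norm_conv:
  "jacobi_norm a b n = sqrt (jacobi_mean a b (jacobi_poly a b n * jacobi_poly a b n))"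
  by (simp add: jacobi_norm_def jacobi_mean_def power2_eq_square)

lemma orthonormal_polynomials_jacobi:
  assumes "a > -1" "b > -1"
  shows "orthonormal_polynomials (jacobi_measure a b) (jacobi_orthonormal a b)"
proof -
  interpret interval_measure "jacobi_measure a b"
    by (rule interval_measure_jacobi[OF assms])
  have norm_sq: "jacobi_mean a b (jacobi_poly a b n * jacobi_poly a b n) > 0" for n
    using coeff_jacobi_poly_pos[OF assms, of n] by (intro jacobi_mean_square_pos assms) auto
  then have norm_pos: "jacobi_norm a b n > 0" for n
    by (simp add: jacobi_norm_conv)
  have degree: "degree (jacobi_orthonormal a b n) = n" for n
    using norm_pos[of n] by (simp add: jacobi_orthonormal_def degree_jacobi_poly[OF assms])
  show ?thesis
  proof
    fix n
    show "degree (jacobi_orthonormal a b n) = n" by (rule degree)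
    show "lead_coeff (jacobi_orthonormal a b n) > 0"
      using norm_pos[of n] coeff_jacobi_poly_pos[OF assms, of n]
      by (simp add: degree) (simp add: jacobi_orthonormal_def)
    show "mean (jacobi_orthonormal a b n * q) = 0" if "degree q < n" for q
      using jacobi_poly_orthogonal[OF assms that]
      by (simp add: jacobi_orthonormal_def jacobi_mean_conv[OF assms] mean_smult)
    have "mean (jacobi_orthonormal a b n * jacobi_orthonormal a b n)
        = jacobi_mean a b (jacobi_poly a b n * jacobi_poly a b n) / (jacobi_norm a b n)\<^sup>2"
      by (simp add: jacobi_orthonormal_def jacobi_mean_conv[OF assms] mean_smult power2_eq_square)
    also have "\<dots> = 1"
      using norm_sq[of n] by (simp add: jacobi_norm_conv)
    finally show "mean (jacobi_orthonormal a b n * jacobi_orthonormal a b n) = 1" .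
  qed
qed

section \<open>Positivity of the Jacobi heat semigroup\<close>

theorem theorem3p3:
  fixes \<alpha> \<beta> t :: real and f :: "nat \<Rightarrow> real"
  assumes "\<beta> \<ge> - 1 / 2" and "\<alpha> \<ge> \<beta>"
    and "bounded (range f)" and "\<forall>n. f n \<ge> 0"
    and "t > 0"
  shows "\<forall>n. jacobi_heat \<alpha> \<beta> t f n \<ge> 0"
proof
  fix n
  interpret orthonormal_polynomials "jacobi_measure \<alpha> \<beta>" "jacobi_orthonormal \<alpha> \<beta>"
    using assms by (intro orthonormal_polynomials_jacobi) auto
  have "jacobi_heat_kernel \<alpha> \<beta> t m n = heat_kernel t m n" for m
    unfolding jacobi_heat_kernel_def heat_kernel_def poly_jacobi_orthonormal ..
  then show "jacobi_heat \<alpha> \<beta> t f n \<ge> 0"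
    using heat_semigroup_nonneg[of t f n] assms by (simp add: jacobi_heat_def)
qed

end
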